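(* Let $R$ be a commutative ring with unity and let $M$ be an $R$-module with $\operatorname{Spec}(M)\neq\emptyset$. Then $\widetilde{\operatorname{Spec}(M)}$ is a Lindelöf space if and only if $\widetilde{\operatorname{Spec}(M)}=\bigcup_{i=1}^{\infty}\widetilde{D}(R-(P_i:M))$ for some countable collection $\{P_i\}_{i=1}^{\infty}$ of prime submodules of $M$ (not necessarily distinct).
   Context: For a submodule $N$ of an $R$-module $M$, $(N:M)=\{r\in R : rM\subseteq N\}$. A proper submodule $P$ of $M$ is prime if whenever $rm\in P$ with $r\in R$, $m\in M$, then $m\in P$ or $r\in(P:M)$; in this case $(P:M)$ is a prime ideal of $R$. $\operatorname{Spec}(M)$ is the set of all prime submodules of $M$. A subset $T\subseteq R$ is multiplicatively closed if $1\in T$ and $xy\in T$ whenever $x,y\in T$. For a family $\mathcal{S}=\{S_i\}_{i\in I}$ of multiplicatively closed subsets of $R$, $\widetilde{V}(\mathcal{S})=\{P\in\operatorname{Spec}(M) \mid (P:M)\cap S_i\neq\emptyset \text{ for all } i\in I\}$. $\widetilde{\operatorname{Spec}(M)}$ denotes the set $\operatorname{Spec}(M)$ with the topology whose closed sets are exactly the sets $\widetilde{V}(\mathcal{S})$, $\mathcal{S}$ ranging over all families of multiplicatively closed subsets of $R$. For a multiplicatively closed subset $T$ of $R$, $\widetilde{D}(T)=\{P\in\operatorname{Spec}(M) \mid (P:M)\cap T=\emptyset\}$, an open set; $R-(P:M)$ is the set complement of $(P:M)$ in $R$. A topological space is Lindelöf if every open cover has a countable subcover. *)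

theory Defs
  imports "HOL-Analysis.Lindelof_Spaces" "HOL-Algebra.Module"
begin

definition residual :: "('a, 'c) ring_scheme \<Rightarrow> ('a, 'b, 'd) module_scheme \<Rightarrow> 'b set \<Rightarrow> 'a set"
  where "residual R M N = {r \<in> carrier R. \<forall>m \<in> carrier M. r \<odot>\<^bsub>M\<^esub> m \<in> N}"

definition prime_submodule ::
    "('a, 'c) ring_scheme \<Rightarrow> ('a, 'b, 'd) module_scheme \<Rightarrow> 'b set \<Rightarrow> bool"
  where "prime_submodule R M P \<longleftrightarrow>
    submodule P R M \<and> P \<noteq> carrier M \<and>
    (\<forall>r \<in> carrier R. \<forall>m \<in> carrier M. r \<odot>\<^bsub>M\<^esub> m \<in> P \<longrightarrow> m \<in> P \<or> r \<in> residual R M P)"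

definition Spec :: "('a, 'c) ring_scheme \<Rightarrow> ('a, 'b, 'd) module_scheme \<Rightarrow> 'b set set"
  where "Spec R M = {P. prime_submodule R M P}"

(* Multiplicatively closed subsets of R are exactly those T with submonoid T R.
   A family of them is represented by the set of its members: V_tilde does not depend
   on the indexing. The empty family is allowed and gives all of Spec R M. *)

definition V_tilde ::
    "('a, 'c) ring_scheme \<Rightarrow> ('a, 'b, 'd) module_scheme \<Rightarrow> 'a set set \<Rightarrow> 'b set set"
  where "V_tilde R M \<S> = {P \<in> Spec R M. \<forall>S \<in> \<S>. residual R M P \<inter> S \<noteq> {}}"

definition D_tilde ::
    "('a, 'c) ring_scheme \<Rightarrow> ('a, 'b, 'd) module_scheme \<Rightarrow> 'a set \<Rightarrow> 'b set set"
  where "D_tilde R M T = {P \<in> Spec R M. residual R M P \<inter> T = {}}"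

(* The axioms of a topology are verified below (istopology_spec_tilde), so that
   the inverse of openin used here is meaningful; see closedin_spec_tilde. *)
definition spec_tilde ::
    "('a, 'c) ring_scheme \<Rightarrow> ('a, 'b, 'd) module_scheme \<Rightarrow> 'b set topology"
  where "spec_tilde R M = topology (\<lambda>U. U \<subseteq> Spec R M \<and>
    (\<exists>\<S>. (\<forall>S \<in> \<S>. submonoid S R) \<and> Spec R M - U = V_tilde R M \<S>))"

lemma residual_smult_closed:
  assumes "Module.module R M" "submodule P R M" "a \<in> residual R M P" "b \<in> carrier R"
  shows "a \<otimes>\<^bsub>R\<^esub> b \<in> residual R M P"
proof -
  interpret Module.module R M by fact
  show ?thesis
    using assms(3,4) by (auto simp: residual_def smult_assoc1)
qed

lemma residual_prime:
  assumes "Module.module R M" "prime_submodule R M P" "a \<in> carrier R" "b \<in> carrier R"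
    and ab: "a \<otimes>\<^bsub>R\<^esub> b \<in> residual R M P"
  shows "a \<in> residual R M P \<or> b \<in> residual R M P"
proof (rule disjCI)
  interpret Module.module R M by fact
  assume "b \<notin> residual R M P"
  then obtain m where m: "m \<in> carrier M" "b \<odot>\<^bsub>M\<^esub> m \<notin> P"
    using assms(4) by (auto simp: residual_def)
  then have "a \<odot>\<^bsub>M\<^esub> (b \<odot>\<^bsub>M\<^esub> m) \<in> P"
    using ab assms(3,4) by (auto simp: residual_def smult_assoc1)
  then show "a \<in> residual R M P"
    using assms(2-4) m by (auto simp: prime_submodule_def)
qed

lemma submonoid_set_mult:
  assumes "cring R" "submonoid S R" "submonoid T R"
  shows "submonoid {s \<otimes>\<^bsub>R\<^esub> t | s t. s \<in> S \<and> t \<in> T} R"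
proof -
  interpret cring R by fact
  interpret S: submonoid S R by fact
  interpret T: submonoid T R by fact
  show ?thesis
  proof (rule submonoid.intro)
    show "{s \<otimes>\<^bsub>R\<^esub> t | s t. s \<in> S \<and> t \<in> T} \<subseteq> carrier R" by auto
    show "\<one>\<^bsub>R\<^esub> \<in> {s \<otimes>\<^bsub>R\<^esub> t | s t. s \<in> S \<and> t \<in> T}"
      using S.one_closed T.one_closed l_one[OF one_closed, symmetric] by blast
  next
    fix x y
    assume "x \<in> {s \<otimes>\<^bsub>R\<^esub> t | s t. s \<in> S \<and> t \<in> T}" "y \<in> {s \<otimes>\<^bsub>R\<^esub> t | s t. s \<in> S \<and> t \<in> T}"
    then obtain s t s' t' where *: "s \<in> S" "t \<in> T" "s' \<in> S" "t' \<in> T"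
      "x = s \<otimes>\<^bsub>R\<^esub> t" "y = s' \<otimes>\<^bsub>R\<^esub> t'" by blast
    have "x \<otimes>\<^bsub>R\<^esub> y = (s \<otimes>\<^bsub>R\<^esub> s') \<otimes>\<^bsub>R\<^esub> (t \<otimes>\<^bsub>R\<^esub> t')"
      using * S.mem_carrier T.mem_carrier by (simp add: m_ac)
    with * show "x \<otimes>\<^bsub>R\<^esub> y \<in> {s \<otimes>\<^bsub>R\<^esub> t | s t. s \<in> S \<and> t \<in> T}" by blast
  qed
qed

lemma V_tilde_Un:
  assumes M: "Module.module R M"
    and S: "\<forall>S \<in> \<S>. submonoid S R" and T: "\<forall>T \<in> \<T>. submonoid T R"
  shows "V_tilde R M \<S> \<union> V_tilde R M \<T> =
    V_tilde R M {{s \<otimes>\<^bsub>R\<^esub> t | s t. s \<in> S \<and> t \<in> T} | S T. S \<in> \<S> \<and> T \<in> \<T>}"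
    (is "_ = V_tilde R M ?ST")
proof (rule Set.set_eqI)
  interpret Module.module R M by fact
  fix P
  show "P \<in> V_tilde R M \<S> \<union> V_tilde R M \<T> \<longleftrightarrow> P \<in> V_tilde R M ?ST"
  proof (cases "P \<in> Spec R M")
    case True
    then have prime: "prime_submodule R M P" and sub: "submodule P R M"
      by (auto simp: Spec_def prime_submodule_def)
    have meet: "residual R M P \<inter> {s \<otimes>\<^bsub>R\<^esub> t | s t. s \<in> S \<and> t \<in> T} \<noteq> {} \<longleftrightarrow>
        residual R M P \<inter> S \<noteq> {} \<or> residual R M P \<inter> T \<noteq> {}"
      if "S \<in> \<S>" "T \<in> \<T>" for S T
    proof -
      interpret S: submonoid S R using S that by blast
      interpret T: submonoid T R using T that by blast
      show ?thesis
      proof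
        assume "residual R M P \<inter> {s \<otimes>\<^bsub>R\<^esub> t | s t. s \<in> S \<and> t \<in> T} \<noteq> {}"
        then obtain s t where "s \<in> S" "t \<in> T" "s \<otimes>\<^bsub>R\<^esub> t \<in> residual R M P" by blast
        then show "residual R M P \<inter> S \<noteq> {} \<or> residual R M P \<inter> T \<noteq> {}"
          using residual_prime[OF M prime] S.mem_carrier T.mem_carrier by blast
      next
        assume "residual R M P \<inter> S \<noteq> {} \<or> residual R M P \<inter> T \<noteq> {}"
        then obtain s t where st: "s \<in> S" "t \<in> T" "s \<in> residual R M P \<or> t \<in> residual R M P"
          using S.one_closed T.one_closed by blast
        then have "s \<otimes>\<^bsub>R\<^esub> t \<in> residual R M P"
          using residual_smult_closed[OF M sub] S.mem_carrier T.mem_carrier m_comm by metis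
        with st show "residual R M P \<inter> {s \<otimes>\<^bsub>R\<^esub> t | s t. s \<in> S \<and> t \<in> T} \<noteq> {}" by blast
      qed
    qed
    have "P \<in> V_tilde R M ?ST \<longleftrightarrow>
        (\<forall>S\<in>\<S>. \<forall>T\<in>\<T>. residual R M P \<inter> {s \<otimes>\<^bsub>R\<^esub> t | s t. s \<in> S \<and> t \<in> T} \<noteq> {})"
      unfolding V_tilde_def using True by blast
    also have "\<dots> \<longleftrightarrow> (\<forall>S\<in>\<S>. \<forall>T\<in>\<T>. residual R M P \<inter> S \<noteq> {} \<or> residual R M P \<inter> T \<noteq> {})"
      using meet by simp
    also have "\<dots> \<longleftrightarrow> P \<in> V_tilde R M \<S> \<union> V_tilde R M \<T>"
      unfolding V_tilde_def using True by blast
    finally show ?thesis by blast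
  qed (auto simp: V_tilde_def)
qed

lemma istopology_spec_tilde:
  assumes M: "Module.module R M"
  shows "istopology (\<lambda>U. U \<subseteq> Spec R M \<and>
    (\<exists>\<S>. (\<forall>S \<in> \<S>. submonoid S R) \<and> Spec R M - U = V_tilde R M \<S>))"
    (is "istopology ?L")
proof -
  have Int: "?L (U \<inter> W)" if "?L U" "?L W" for U W
  proof -
    from that(1) obtain \<S> where S: "\<forall>S \<in> \<S>. submonoid S R" "Spec R M - U = V_tilde R M \<S>"
      by (elim conjE exE)
    from that(2) obtain \<T> where T: "\<forall>T \<in> \<T>. submonoid T R" "Spec R M - W = V_tilde R M \<T>"
      by (elim conjE exE)
    let ?ST = "{{s \<otimes>\<^bsub>R\<^esub> t | s t. s \<in> S \<and> t \<in> T} | S T. S \<in> \<S> \<and> T \<in> \<T>}"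
    have "\<forall>S \<in> ?ST. submonoid S R"
      using submonoid_set_mult[OF Module.module.axioms(1)[OF M]] S(1) T(1) by auto
    moreover have "Spec R M - (U \<inter> W) = V_tilde R M ?ST"
      using V_tilde_Un[OF M S(1) T(1)] S(2) T(2) Diff_Int[of "Spec R M" U W] by simp
    moreover have "U \<inter> W \<subseteq> Spec R M" using that(1) by blast
    ultimately show ?thesis by (intro conjI exI[of _ ?ST])
  qed
  have Un: "?L (\<Union>\<K>)" if K: "\<forall>U\<in>\<K>. ?L U" for \<K>
  proof -
    obtain F where F: "\<forall>U\<in>\<K>. (\<forall>S \<in> F U. submonoid S R) \<and> Spec R M - U = V_tilde R M (F U)"
      using K by metis
    have "Spec R M - \<Union>\<K> = {P \<in> Spec R M. \<forall>U\<in>\<K>. P \<in> Spec R M - U}" by blast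
    also have "\<dots> = {P \<in> Spec R M. \<forall>U\<in>\<K>. P \<in> V_tilde R M (F U)}" using F by auto
    also have "\<dots> = V_tilde R M (\<Union>(F ` \<K>))" unfolding V_tilde_def by blast
    finally have "Spec R M - \<Union>\<K> = V_tilde R M (\<Union>(F ` \<K>))" .
    moreover have "\<forall>S \<in> \<Union>(F ` \<K>). submonoid S R" using F by blast
    moreover have "\<Union>\<K> \<subseteq> Spec R M" using K by blast
    ultimately show ?thesis by (intro conjI exI[of _ "\<Union>(F ` \<K>)"])
  qed
  show ?thesis unfolding istopology_def using Int Un by blast
qed

lemma openin_spec_tilde:
  assumes "Module.module R M"
  shows "openin (spec_tilde R M) U \<longleftrightarrow> U \<subseteq> Spec R M \<and>
    (\<exists>\<S>. (\<forall>S \<in> \<S>. submonoid S R) \<and> Spec R M - U = V_tilde R M \<S>)"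
  unfolding spec_tilde_def
  by (subst topology_inverse'[OF istopology_spec_tilde[OF assms]]) (rule refl)

lemma openin_D_tilde:
  assumes "Module.module R M" "submonoid T R"
  shows "openin (spec_tilde R M) (D_tilde R M T)"
proof -
  have "Spec R M - D_tilde R M T = V_tilde R M {T}"
    by (auto simp: D_tilde_def V_tilde_def)
  then show ?thesis
    unfolding openin_spec_tilde[OF assms(1)] using assms(2)
    by (intro conjI exI[of _ "{T}"]) (auto simp: D_tilde_def)
qed

lemma topspace_spec_tilde:
  assumes "Module.module R M"
  shows "topspace (spec_tilde R M) = Spec R M"
proof -
  interpret Module.module R M by fact
  have "submonoid {\<one>\<^bsub>R\<^esub>} R" by (rule submonoid.intro) auto
  moreover have "residual R M P \<inter> {\<one>\<^bsub>R\<^esub>} = {}" if "P \<in> Spec R M" for P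
  proof -
    have "subgroup P (add_monoid M)" "P \<noteq> carrier M"
      using that by (auto simp: Spec_def prime_submodule_def submodule_def)
    then show ?thesis
      using subgroup.subset[of P "add_monoid M"] by (auto simp: residual_def)
  qed
  then have "D_tilde R M {\<one>\<^bsub>R\<^esub>} = Spec R M" by (auto simp: D_tilde_def)
  ultimately have "openin (spec_tilde R M) (Spec R M)"
    using openin_D_tilde[OF assms] by metis
  then show ?thesis
    using openin_spec_tilde[OF assms, of "topspace (spec_tilde R M)"] openin_subset
    by (metis openin_topspace subset_antisym)
qed

lemma closedin_spec_tilde:
  assumes "Module.module R M"
  shows "closedin (spec_tilde R M) C \<longleftrightarrow>
    (\<exists>\<S>. (\<forall>S \<in> \<S>. submonoid S R) \<and> C = V_tilde R M \<S>)"
proof -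
  have "V_tilde R M \<S> \<subseteq> Spec R M" for \<S> by (auto simp: V_tilde_def)
  then show ?thesis
    unfolding closedin_def topspace_spec_tilde[OF assms] openin_spec_tilde[OF assms]
    by (metis Diff_subset double_diff order_refl)
qed

end

theory Submission
  imports Defs
begin

text \<open>
  The set \<open>D_tilde R M (R - (P:M)) = {Q. (Q:M) \<subseteq> (P:M)}\<close> is the least open neighbourhood of \<open>P\<close>:
  a set \<open>S\<close> disjoint from \<open>(P:M)\<close> is disjoint from every smaller \<open>(Q:M)\<close>. Hence a countable
  subcover of the cover by these least neighbourhoods gives the \<open>P\<^sub>i\<close>; conversely, given the
  \<open>P\<^sub>i\<close>, from any open cover it suffices to choose one member containing each \<open>P\<^sub>i\<close>.
\<close>

text \<open>Residuals lie in \<open>carrier R\<close>, so missing the complement of one means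
  inclusion in it.\<close>

lemma D_tilde_Compl_residual:
  "D_tilde R M (carrier R - residual R M P) = {Q \<in> Spec R M. residual R M Q \<subseteq> residual R M P}"
  unfolding D_tilde_def by (auto simp: residual_def)

text \<open>The residual of a prime submodule is a prime ideal: closure under products is the
  contrapositive of \<open>residual_prime\<close>, and a residual containing one would force
  \<open>P = carrier M\<close>.\<close>

lemma submonoid_Compl_residual:
  assumes M: "Module.module R M" and P: "P \<in> Spec R M"
  shows "submonoid (carrier R - residual R M P) R"
proof -
  interpret Module.module R M by fact
  have prime: "prime_submodule R M P"
    using P by (simp add: Spec_def)
  show ?thesis
  proof (rule submonoid.intro)
    have "P \<subset> carrier M"
      using prime subgroup.subset[of P "add_monoid M"]
      by (auto simp: prime_submodule_def submodule_def)
    then show "\<one>\<^bsub>R\<^esub> \<in> carrier R - residual R M P"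
      by (auto simp: residual_def)
  qed (use residual_prime[OF M prime] in auto)
qed

lemma openin_spec_tilde_down_closed:
  assumes "Module.module R M" "openin (spec_tilde R M) U" "P \<in> U"
    and "Q \<in> Spec R M" "residual R M Q \<subseteq> residual R M P"
  shows "Q \<in> U"
proof -
  obtain \<S> where "U \<subseteq> Spec R M" and U: "Spec R M - U = V_tilde R M \<S>"
    using assms(2) unfolding openin_spec_tilde[OF assms(1)] by blast
  \<comment> \<open>Some member of \<open>\<S>\<close> misses the residual of \<open>P\<close>,
    hence also the smaller residual of \<open>Q\<close>.\<close>
  then have "P \<in> Spec R M" "P \<notin> V_tilde R M \<S>"
    using assms(3) by blast+
  then have "Q \<notin> V_tilde R M \<S>"
    using assms(5) by (fastforce simp: V_tilde_def)
  then show ?thesis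
    using U assms(4) by blast
qed

theorem theorem14:
  fixes R :: "('a, 'c) ring_scheme" and M :: "('a, 'b, 'd) module_scheme"
  assumes "Module.module R M"
    and "Spec R M \<noteq> {}"
  shows "Lindelof_space (spec_tilde R M) \<longleftrightarrow>
    (\<exists>P :: nat \<Rightarrow> 'b set. (\<forall>i. prime_submodule R M (P i)) \<and>
      topspace (spec_tilde R M) = (\<Union>i. D_tilde R M (carrier R - residual R M (P i))))"
    (is "?L \<longleftrightarrow> (\<exists>P. ?E P)")
proof -
  define D where "D P = D_tilde R M (carrier R - residual R M P)" for P
  have D: "D P = {Q \<in> Spec R M. residual R M Q \<subseteq> residual R M P}" for P
    unfolding D_def by (rule D_tilde_Compl_residual)
  note top = topspace_spec_tilde[OF assms(1)]
  show ?thesis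
  proof
    assume ?L
    moreover have "\<forall>U \<in> D ` Spec R M. openin (spec_tilde R M) U"
      unfolding D_def
      using openin_D_tilde[OF assms(1) submonoid_Compl_residual[OF assms(1)]] by blast
    moreover have UN: "\<Union> (D ` Spec R M) = topspace (spec_tilde R M)"
      unfolding top D by blast
    ultimately obtain \<V> where \<V>: "countable \<V>" "\<V> \<subseteq> D ` Spec R M"
        "\<Union>\<V> = topspace (spec_tilde R M)"
      unfolding Lindelof_space_def by meson
    \<comment> \<open>\<open>D\<close> need not be injective, so one prime submodule is chosen for
      each member of \<open>\<V>\<close>.\<close>
    then obtain A where A: "countable A" "A \<subseteq> Spec R M" "\<V> = D ` A"
      by (meson countable_subset_image)
    \<comment> \<open>Nonemptiness lets \<open>from_nat_into\<close> enumerate exactly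
      \<open>A\<close>, with repetitions if \<open>A\<close> is finite.\<close>
    have "A \<noteq> {}"
      using \<V>(3) A(3) top assms(2) by auto
    then have range: "range (from_nat_into A) = A"
      using A(1) by (rule range_from_nat_into)
    have "topspace (spec_tilde R M) = (\<Union>i. D (from_nat_into A i))"
      using \<V>(3) A(3) by (subst (asm) range[symmetric]) (simp add: image_image)
    moreover have "prime_submodule R M (from_nat_into A i)" for i
      using range A(2) by (auto simp: Spec_def)
    ultimately show "\<exists>P. ?E P"
      unfolding D_def by blast
  next
    assume "\<exists>P. ?E P"
    then obtain P where P: "\<And>i. P i \<in> Spec R M"
        and cover: "Spec R M = (\<Union>i::nat. D (P i))"
      unfolding top D_def by (auto simp: Spec_def)
    show ?L
      unfolding Lindelof_space_def
    proof (intro allI impI, elim conjE)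
      fix \<U>
      assume open_U: "\<forall>U \<in> \<U>. openin (spec_tilde R M) U"
        and UN: "\<Union>\<U> = topspace (spec_tilde R M)"
      then have "\<forall>i. \<exists>U \<in> \<U>. P i \<in> U"
        using P top by (metis UnionE)
      then obtain U where U: "\<And>i. U i \<in> \<U>" "\<And>i. P i \<in> U i"
        by metis
      \<comment> \<open>Minimality of the neighbourhood \<open>D (P i)\<close>: the chosen
        \<open>U i\<close> then cover whatever the \<open>D (P i)\<close> cover.\<close>
      have "D (P i) \<subseteq> U i" for i
        unfolding D using openin_spec_tilde_down_closed[OF assms(1) _ U(2)] open_U U(1) by blast
      then have "Spec R M \<subseteq> \<Union> (range U)"
        unfolding cover by blast
      moreover have "\<Union> (range U) \<subseteq> Spec R M"
        using U(1) UN top by blast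
      ultimately have "countable (range U) \<and> range U \<subseteq> \<U> \<and> \<Union> (range U) = topspace (spec_tilde R M)"
        using U(1) top by auto
      then show "\<exists>\<V>. countable \<V> \<and> \<V> \<subseteq> \<U> \<and> \<Union>\<V> = topspace (spec_tilde R M)"
        by blast
    qed
  qed
qed

end
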